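(* Let $A$ be an associative ordered blueprint. Then the following operations make the set of order flats of $A$ into a quantic semiring: $$\bigvee_\alpha S_\alpha=\bigcup_\alpha S_\alpha,\qquad S\odot T=(S\cdot T)^{\leqslant},$$ $$S\oplus T=\{a\in A\mid a\leqslant s+t\text{ for some }s\in S,\ t\in T\},\qquad 0=\{a\in A\mid a\leqslant\textstyle\sum_{\emptyset}\},$$ where $\sum_\emptyset$ denotes the empty sum.
   Context: An ordered blueprint $(A,\cdot,\leqslant)$ is a multiplicative commutative monoid $A$ with absorbing element $0$, together with a preorder $\leqslant$ on the semiring $\mathbb N[A]^+$ of formal finite sums of elements of $A$, compatible with the addition and multiplication of $\mathbb N[A]^+$, such that $0\leqslant\sum_\emptyset$ and $\sum_\emptyset\leqslant0$ (with $\sum_\emptyset$ the empty sum, $0\in A$ the absorbing element), and such that $a\leqslant b$ and $b\leqslant a$ imply $a=b$ for $a,b\in A$. It is associative if whenever $a\leqslant s+t+u$ with $a,s,t,u\in A$, there is some $b\in A$ with $b\leqslant s+t$ and $a\leqslant b+u$. For $S\subset A$, $S^{\leqslant}=\{a\in A\mid a\leqslant s\text{ for some }s\in S\}$; an order flat is a subset $S$ with $S^{\leqslant}=S$. Also $S\cdot T=\{st\mid s\in S,t\in T\}$. A quantale is a triple $(\mathcal Q,\bigvee,\cdot)$ where $(\mathcal Q,\bigvee)$ is a poset with all suprema and $\cdot$ is an associative multiplication distributing over arbitrary joins in each variable. A quantic semiring is a tuple $(\mathcal S,\bigvee,\cdot,+,0)$ such that: $(\mathcal S,\bigvee,\cdot)$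 is a quantale; $(\mathcal S,+,0)$ is a commutative monoid; $+$ distributes over non-empty countable joins; $S\cdot(T+U)\le S\cdot T+S\cdot U$ and $(S+T)\cdot U\le S\cdot U+T\cdot U$ for all $S,T,U$; and $0\cdot S\le0$, $S\cdot0\le0$ for all $S$. *)

theory Defs
  imports
    "HOL-Library.Multiset"
    "HOL-Library.Countable_Set"
    "HOL-Library.Set_Algebras"
    "HOL-Algebra.Group"
    "HOL-Algebra.Order"
begin

section \<open>Ordered blueprints\<close>

text \<open>
  The underlying monoid with zero \<open>A\<close> is the whole type \<open>'a\<close>. The semiring \<open>\<nat>[A]\<^sup>+\<close> of formal
  finite sums is \<open>'a multiset\<close>: an element \<open>a\<close> of \<open>A\<close> is the singleton \<open>{#a#}\<close>, addition is
  multiset union and the empty sum is \<open>{#}\<close>, which differs from \<open>{#0#}\<close>.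
  Multiplication is the bilinear extension of the product of \<open>A\<close>.
\<close>

definition formal_mult :: "'a::times multiset \<Rightarrow> 'a multiset \<Rightarrow> 'a multiset"
  where "formal_mult x y = (\<Sum>a\<in>#x. \<Sum>b\<in>#y. {#a * b#})"

locale ordered_blueprint =
  fixes le :: "'a::{comm_monoid_mult, mult_zero} multiset \<Rightarrow> 'a multiset \<Rightarrow> bool"  (infix \<open>\<preceq>\<close> 50)
  assumes le_reflexive: "x \<preceq> x"
    and le_transitive: "x \<preceq> y \<Longrightarrow> y \<preceq> z \<Longrightarrow> x \<preceq> z"
    and le_add: "x \<preceq> y \<Longrightarrow> z \<preceq> w \<Longrightarrow> x + z \<preceq> y + w"
    and le_mult: "x \<preceq> y \<Longrightarrow> z \<preceq> w \<Longrightarrow> formal_mult x z \<preceq> formal_mult y w"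
    and zero_le_empty: "{#0#} \<preceq> {#}"
    and empty_le_zero: "{#} \<preceq> {#0#}"
    and le_antisymmetric: "{#a#} \<preceq> {#b#} \<Longrightarrow> {#b#} \<preceq> {#a#} \<Longrightarrow> a = b"

locale associative_ordered_blueprint = ordered_blueprint +
  assumes le_associative:
    "{#a#} \<preceq> {#s#} + {#t#} + {#u#} \<Longrightarrow> \<exists>b. {#b#} \<preceq> {#s#} + {#t#} \<and> {#a#} \<preceq> {#b#} + {#u#}"


section \<open>Order flats\<close>

definition down_closure :: "('a multiset \<Rightarrow> 'a multiset \<Rightarrow> bool) \<Rightarrow> 'a set \<Rightarrow> 'a set"
  where "down_closure r S = {a. \<exists>s\<in>S. r {#a#} {#s#}}"

definition order_flats :: "('a multiset \<Rightarrow> 'a multiset \<Rightarrow> bool) \<Rightarrow> 'a set set"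
  where "order_flats r = {S. down_closure r S = S}"

text \<open>Below, \<open>S * T\<close> is the elementwise product of sets.\<close>

definition flat_mult :: "('a::times multiset \<Rightarrow> 'a multiset \<Rightarrow> bool) \<Rightarrow> 'a set \<Rightarrow> 'a set \<Rightarrow> 'a set"
  where "flat_mult r S T = down_closure r (S * T)"

definition flat_add :: "('a multiset \<Rightarrow> 'a multiset \<Rightarrow> bool) \<Rightarrow> 'a set \<Rightarrow> 'a set \<Rightarrow> 'a set"
  where "flat_add r S T = {a. \<exists>s\<in>S. \<exists>t\<in>T. r {#a#} ({#s#} + {#t#})}"

definition flat_zero :: "('a multiset \<Rightarrow> 'a multiset \<Rightarrow> bool) \<Rightarrow> 'a set"
  where "flat_zero r = {a. r {#a#} {#}}"


section \<open>Quantales and quantic semirings\<close>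

text \<open>
  The structures live on a carrier \<open>Q\<close>; the partial order is given explicitly along with the
  join operation. Joins over subsets of \<open>Q\<close> cover joins of all indexed families, since a join
  depends only on the set of its members.
\<close>

locale quantale =
  fixes Q :: "'q set"
    and leq :: "'q \<Rightarrow> 'q \<Rightarrow> bool"  (infix \<open>\<lesssim>\<close> 50)
    and Join :: "'q set \<Rightarrow> 'q"
    and qmult :: "'q \<Rightarrow> 'q \<Rightarrow> 'q"  (infixl \<open>\<odot>\<close> 70)
  assumes partial_order: "partial_order \<lparr>carrier = Q, eq = (=), le = (\<lesssim>)\<rparr>"
    and Join_lub: "X \<subseteq> Q \<Longrightarrow>
      least \<lparr>carrier = Q, eq = (=), le = (\<lesssim>)\<rparr> (Join X) (Upper \<lparr>carrier = Q, eq = (=), le = (\<lesssim>)\<rparr> X)"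
    and mult_closed: "x \<in> Q \<Longrightarrow> y \<in> Q \<Longrightarrow> x \<odot> y \<in> Q"
    and mult_assoc: "x \<in> Q \<Longrightarrow> y \<in> Q \<Longrightarrow> z \<in> Q \<Longrightarrow> (x \<odot> y) \<odot> z = x \<odot> (y \<odot> z)"
    and mult_Join_right: "x \<in> Q \<Longrightarrow> Y \<subseteq> Q \<Longrightarrow> x \<odot> Join Y = Join ((\<lambda>y. x \<odot> y) ` Y)"
    and mult_Join_left: "X \<subseteq> Q \<Longrightarrow> y \<in> Q \<Longrightarrow> Join X \<odot> y = Join ((\<lambda>x. x \<odot> y) ` X)"

locale quantic_semiring = quantale Q leq Join qmult
  for Q :: "'q set"
    and leq :: "'q \<Rightarrow> 'q \<Rightarrow> bool"  (infix \<open>\<lesssim>\<close> 50)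
    and Join :: "'q set \<Rightarrow> 'q"
    and qmult :: "'q \<Rightarrow> 'q \<Rightarrow> 'q"  (infixl \<open>\<odot>\<close> 70) +
  fixes qadd :: "'q \<Rightarrow> 'q \<Rightarrow> 'q"  (infixl \<open>\<oplus>\<close> 65)
    and qzero :: 'q
  assumes add_comm_monoid: "comm_monoid \<lparr>carrier = Q, mult = (\<oplus>), one = qzero\<rparr>"
    and add_Join_right: "x \<in> Q \<Longrightarrow> Y \<subseteq> Q \<Longrightarrow> Y \<noteq> {} \<Longrightarrow> countable Y \<Longrightarrow>
      x \<oplus> Join Y = Join ((\<lambda>y. x \<oplus> y) ` Y)"
    and add_Join_left: "X \<subseteq> Q \<Longrightarrow> X \<noteq> {} \<Longrightarrow> countable X \<Longrightarrow> y \<in> Q \<Longrightarrow>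
      Join X \<oplus> y = Join ((\<lambda>x. x \<oplus> y) ` X)"
    and left_subdistrib: "x \<in> Q \<Longrightarrow> y \<in> Q \<Longrightarrow> z \<in> Q \<Longrightarrow> x \<odot> (y \<oplus> z) \<lesssim> x \<odot> y \<oplus> x \<odot> z"
    and right_subdistrib: "x \<in> Q \<Longrightarrow> y \<in> Q \<Longrightarrow> z \<in> Q \<Longrightarrow> (x \<oplus> y) \<odot> z \<lesssim> x \<odot> z \<oplus> y \<odot> z"
    and zero_mult_le: "x \<in> Q \<Longrightarrow> qzero \<odot> x \<lesssim> qzero"
    and mult_zero_le: "x \<in> Q \<Longrightarrow> x \<odot> qzero \<lesssim> qzero"

end

theory Submission
  imports Defs
begin

text \<open>
  Writing \<open>a \<preceq> s + t + u\<close> with \<open>s\<close>, \<open>t\<close>, \<open>u\<close> in three given flats is symmetric in the flats.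
  Associativity of the blueprint says precisely that the bracketed sum \<open>(S \<oplus> T) \<oplus> U\<close> consists of
  these elements \<open>a\<close>, so \<open>\<oplus>\<close> is associative. The remaining laws need only the compatibility
  of \<open>\<preceq>\<close> with sums and products of formal sums.
\<close>

text \<open>The mixed rules fix one factor to be a single element: the proofs below multiply an
  inequality of formal sums only by a singleton.\<close>

lemma formal_mult_simps [simp]:
  "formal_mult {#a#} {#b#} = {#a * b#}"
  "formal_mult {#a#} (x + y) = formal_mult {#a#} x + formal_mult {#a#} y"
  "formal_mult (x + y) {#b#} = formal_mult x {#b#} + formal_mult y {#b#}"
  "formal_mult {#} y = {#}"
  "formal_mult x {#} = {#}"
  by (simp_all add: formal_mult_def)

lemma mem_flat_mult:
  "a \<in> flat_mult r S T \<longleftrightarrow> (\<exists>s\<in>S. \<exists>t\<in>T. r {#a#} {#s * t#})"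
  by (force simp: flat_mult_def down_closure_def elim!: set_times_elim)

lemma mem_flat_add:
  "a \<in> flat_add r S T \<longleftrightarrow> (\<exists>s\<in>S. \<exists>t\<in>T. r {#a#} ({#s#} + {#t#}))"
  by (simp add: flat_add_def)

lemma mem_flat_zero: "a \<in> flat_zero r \<longleftrightarrow> r {#a#} {#}"
  by (simp add: flat_zero_def)

lemma flat_mult_commute:
  fixes S T :: "'a::comm_monoid_mult set"
  shows "flat_mult r S T = flat_mult r T S"
  unfolding set_eq_iff mem_flat_mult by (metis mult.commute)

text \<open>Membership asks for one witness from each factor, and a witness from a union lies in
  some member of the family. The empty family is covered: both sides are then empty.\<close>

lemma flat_mult_Union_right: "flat_mult r S (\<Union>X) = \<Union>(flat_mult r S ` X)"
  unfolding set_eq_iff UN_iff Bex_def mem_flat_mult by blast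

lemma flat_mult_Union_left: "flat_mult r (\<Union>X) T = \<Union>((\<lambda>S. flat_mult r S T) ` X)"
  unfolding set_eq_iff UN_iff Bex_def mem_flat_mult by blast

lemma flat_add_commute: "flat_add r S T = flat_add r T S"
  unfolding set_eq_iff mem_flat_add by (metis add.commute)

lemma flat_add_Union_right: "flat_add r S (\<Union>X) = \<Union>(flat_add r S ` X)"
  unfolding set_eq_iff UN_iff Bex_def mem_flat_add by blast

lemma flat_add_Union_left: "flat_add r (\<Union>X) T = \<Union>((\<lambda>S. flat_add r S T) ` X)"
  unfolding set_eq_iff UN_iff Bex_def mem_flat_add by blast

context ordered_blueprint
begin

lemma le_mult_left: "x \<preceq> y \<Longrightarrow> formal_mult z x \<preceq> formal_mult z y"
  by (rule le_mult[OF le_reflexive])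

lemma le_mult_right: "x \<preceq> y \<Longrightarrow> formal_mult x z \<preceq> formal_mult y z"
  by (rule le_mult[OF _ le_reflexive])

lemma le_add_right: "x \<preceq> y \<Longrightarrow> x + z \<preceq> y + z"
  by (rule le_add[OF _ le_reflexive])

text \<open>Reflexivity puts every set inside its down closure, so being an order flat reduces to
  being downward closed.\<close>

lemma order_flats_iff:
  "S \<in> order_flats (\<preceq>) \<longleftrightarrow> (\<forall>s\<in>S. \<forall>a. {#a#} \<preceq> {#s#} \<longrightarrow> a \<in> S)"
  by (auto simp: order_flats_def down_closure_def intro: le_reflexive)

lemma order_flatsD: "S \<in> order_flats (\<preceq>) \<Longrightarrow> s \<in> S \<Longrightarrow> {#a#} \<preceq> {#s#} \<Longrightarrow> a \<in> S"
  by (simp add: order_flats_iff)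

lemma Union_in_order_flats: "X \<subseteq> order_flats (\<preceq>) \<Longrightarrow> \<Union>X \<in> order_flats (\<preceq>)"
  unfolding order_flats_iff[of "\<Union>X"] by (blast dest: order_flatsD)

lemma flat_mult_in_order_flats: "flat_mult (\<preceq>) S T \<in> order_flats (\<preceq>)"
  unfolding order_flats_iff Ball_def Bex_def mem_flat_mult by (blast intro: le_transitive)

lemma flat_add_in_order_flats: "flat_add (\<preceq>) S T \<in> order_flats (\<preceq>)"
  unfolding order_flats_iff Ball_def Bex_def mem_flat_add by (blast intro: le_transitive)

lemma flat_zero_in_order_flats: "flat_zero (\<preceq>) \<in> order_flats (\<preceq>)"
  unfolding order_flats_iff Ball_def Bex_def mem_flat_zero by (blast intro: le_transitive)

text \<open>The inner down closure is absorbed, since multiplying by \<open>u\<close> preserves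
  \<open>\<preceq>\<close>; conversely \<open>s * t\<close> itself lies in the inner product. The
  right-hand side treats the three sets alike, which prepares associativity.\<close>

lemma mem_flat_mult_mult_left:
  "a \<in> flat_mult (\<preceq>) (flat_mult (\<preceq>) S T) U \<longleftrightarrow>
    (\<exists>s\<in>S. \<exists>t\<in>T. \<exists>u\<in>U. {#a#} \<preceq> {#s * t * u#})" (is "?L \<longleftrightarrow> ?R")
proof
  assume ?L
  then obtain b s t u where "s \<in> S" "t \<in> T" "u \<in> U"
    and b: "{#b#} \<preceq> {#s * t#}" and a: "{#a#} \<preceq> {#b * u#}"
    by (auto simp: mem_flat_mult)
  moreover have "{#b * u#} \<preceq> {#s * t * u#}"
    using le_mult_right[OF b, of "{#u#}"] by simp
  ultimately show ?R
    using le_transitive[OF a] by blast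
next
  assume ?R
  then show ?L
    unfolding Bex_def mem_flat_mult by (blast intro: le_reflexive)
qed

lemma flat_mult_assoc:
  "flat_mult (\<preceq>) (flat_mult (\<preceq>) S T) U = flat_mult (\<preceq>) S (flat_mult (\<preceq>) T U)"
proof (intro Set.set_eqI)
  fix a
  have "a \<in> flat_mult (\<preceq>) S (flat_mult (\<preceq>) T U) \<longleftrightarrow>
      (\<exists>t\<in>T. \<exists>u\<in>U. \<exists>s\<in>S. {#a#} \<preceq> {#t * u * s#})"
    \<comment> \<open>Commutativity moves \<open>S\<close> to the right, so the description of
      left-bracketed products also covers this bracketing.\<close>
    by (subst flat_mult_commute) (rule mem_flat_mult_mult_left)
  also have "\<dots> \<longleftrightarrow> (\<exists>t\<in>T. \<exists>u\<in>U. \<exists>s\<in>S. {#a#} \<preceq> {#s * t * u#})"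
    by (intro bex_cong refl) (simp add: ac_simps)
  also have "\<dots> \<longleftrightarrow> (\<exists>s\<in>S. \<exists>t\<in>T. \<exists>u\<in>U. {#a#} \<preceq> {#s * t * u#})"
    by blast
  finally show "a \<in> flat_mult (\<preceq>) (flat_mult (\<preceq>) S T) U \<longleftrightarrow>
      a \<in> flat_mult (\<preceq>) S (flat_mult (\<preceq>) T U)"
    by (simp add: mem_flat_mult_mult_left)
qed

lemma flat_zero_add:
  assumes "S \<in> order_flats (\<preceq>)"
  shows "flat_add (\<preceq>) (flat_zero (\<preceq>)) S = S"
proof (intro Set.set_eqI iffI)
  fix a assume "a \<in> flat_add (\<preceq>) (flat_zero (\<preceq>)) S"
  then obtain z s where "s \<in> S" and z: "{#z#} \<preceq> {#}" and a: "{#a#} \<preceq> {#z#} + {#s#}"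
    by (auto simp: mem_flat_add mem_flat_zero)
  have "{#a#} \<preceq> {#s#}"
    using le_transitive[OF a le_add_right[OF z]] by simp
  then show "a \<in> S"
    using assms \<open>s \<in> S\<close> by (blast dest: order_flatsD)
next
  fix a assume "a \<in> S"
  moreover have "{#a#} \<preceq> {#0#} + {#a#}"
    using le_add_right[OF empty_le_zero, of "{#a#}"] by simp
  ultimately show "a \<in> flat_add (\<preceq>) (flat_zero (\<preceq>)) S"
    using zero_le_empty unfolding Bex_def mem_flat_add mem_flat_zero by blast
qed

text \<open>Multiplying \<open>b \<preceq> t + u\<close> by \<open>s\<close> gives the inclusion. It
  is one-sided in general because on the right the two summands may use different elements of
  \<open>S\<close>.\<close>

lemma flat_mult_add_subset:
  "flat_mult (\<preceq>) S (flat_add (\<preceq>) T U) \<subseteq>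
    flat_add (\<preceq>) (flat_mult (\<preceq>) S T) (flat_mult (\<preceq>) S U)"
proof
  fix a assume "a \<in> flat_mult (\<preceq>) S (flat_add (\<preceq>) T U)"
  then obtain s b t u where "s \<in> S" "t \<in> T" "u \<in> U"
    and a: "{#a#} \<preceq> {#s * b#}" and b: "{#b#} \<preceq> {#t#} + {#u#}"
    unfolding Bex_def mem_flat_mult mem_flat_add by blast
  have "{#s * b#} \<preceq> {#s * t#} + {#s * u#}"
    using le_mult_left[OF b, of "{#s#}"]
    \<comment> \<open>The deleted rules would merge the sum into nested \<open>add_mset\<close>,
      hiding the \<open>+\<close> over which \<open>formal_mult\<close> distributes.\<close>
    by (simp del: union_mset_add_mset_left union_mset_add_mset_right)
  then have "{#a#} \<preceq> {#s * t#} + {#s * u#}"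
    by (rule le_transitive[OF a])
  then show "a \<in> flat_add (\<preceq>) (flat_mult (\<preceq>) S T) (flat_mult (\<preceq>) S U)"
    using \<open>s \<in> S\<close> \<open>t \<in> T\<close> \<open>u \<in> U\<close> unfolding Bex_def mem_flat_mult mem_flat_add
    by (blast intro: le_reflexive)
qed

text \<open>If \<open>z\<close> is below the empty sum, so is \<open>z * s\<close>, because the
  empty sum times \<open>s\<close> is again empty.\<close>

lemma flat_zero_mult_subset: "flat_mult (\<preceq>) (flat_zero (\<preceq>)) S \<subseteq> flat_zero (\<preceq>)"
proof
  fix a assume "a \<in> flat_mult (\<preceq>) (flat_zero (\<preceq>)) S"
  then obtain z s where z: "{#z#} \<preceq> {#}" and a: "{#a#} \<preceq> {#z * s#}"
    by (auto simp: mem_flat_mult mem_flat_zero)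
  show "a \<in> flat_zero (\<preceq>)"
    using le_transitive[OF a] le_mult_right[OF z, of "{#s#}"] by (simp add: mem_flat_zero)
qed

end

context associative_ordered_blueprint
begin

lemma mem_flat_add_add_left:
  "a \<in> flat_add (\<preceq>) (flat_add (\<preceq>) S T) U \<longleftrightarrow>
    (\<exists>s\<in>S. \<exists>t\<in>T. \<exists>u\<in>U. {#a#} \<preceq> {#s#} + {#t#} + {#u#})" (is "?L \<longleftrightarrow> ?R")
proof
  assume ?L
  then obtain b s t u where "s \<in> S" "t \<in> T" "u \<in> U"
    and b: "{#b#} \<preceq> {#s#} + {#t#}" and a: "{#a#} \<preceq> {#b#} + {#u#}"
    unfolding Bex_def mem_flat_add by blast
  then show ?R
    using le_transitive[OF a le_add_right[OF b]] by blast
next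
  assume ?R
  then show ?L
    \<comment> \<open>The \<open>b\<close> supplied by \<open>le_associative\<close> is the element
      of the inner sum \<open>S \<oplus> T\<close>; the other direction is just monotonicity of
      addition.\<close>
    unfolding Bex_def mem_flat_add by (blast dest: le_associative)
qed

lemma flat_add_assoc:
  "flat_add (\<preceq>) (flat_add (\<preceq>) S T) U = flat_add (\<preceq>) S (flat_add (\<preceq>) T U)"
proof (intro Set.set_eqI)
  fix a
  have "a \<in> flat_add (\<preceq>) S (flat_add (\<preceq>) T U) \<longleftrightarrow>
      (\<exists>t\<in>T. \<exists>u\<in>U. \<exists>s\<in>S. {#a#} \<preceq> {#t#} + {#u#} + {#s#})"
    by (subst flat_add_commute) (rule mem_flat_add_add_left)
  also have "\<dots> \<longleftrightarrow> (\<exists>t\<in>T. \<exists>u\<in>U. \<exists>s\<in>S. {#a#} \<preceq> {#s#} + {#t#} + {#u#})"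
    by (intro bex_cong refl) (simp add: add_mset_commute)
  also have "\<dots> \<longleftrightarrow> (\<exists>s\<in>S. \<exists>t\<in>T. \<exists>u\<in>U. {#a#} \<preceq> {#s#} + {#t#} + {#u#})"
    by blast
  finally show "a \<in> flat_add (\<preceq>) (flat_add (\<preceq>) S T) U \<longleftrightarrow>
      a \<in> flat_add (\<preceq>) S (flat_add (\<preceq>) T U)"
    by (simp only: mem_flat_add_add_left)
qed

lemma flat_add_comm_monoid:
  "comm_monoid \<lparr>carrier = order_flats (\<preceq>), mult = flat_add (\<preceq>), one = flat_zero (\<preceq>)\<rparr>"
proof (rule comm_monoidI; simp)
  fix S T U
  show "flat_add (\<preceq>) (flat_add (\<preceq>) S T) U = flat_add (\<preceq>) S (flat_add (\<preceq>) T U)"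
    by (rule flat_add_assoc)
  show "flat_add (\<preceq>) S T = flat_add (\<preceq>) T S"
    by (rule flat_add_commute)
qed (simp_all add: flat_add_in_order_flats flat_zero_in_order_flats flat_zero_add)

lemma quantale_order_flats:
  "quantale (order_flats (\<preceq>)) (\<subseteq>) (\<lambda>X. \<Union>X) (flat_mult (\<preceq>))"
proof (rule quantale.intro)
  show "partial_order \<lparr>carrier = order_flats (\<preceq>), eq = (=), le = (\<subseteq>)\<rparr>"
    by unfold_locales auto
qed (auto simp: least_def Upper_def Union_in_order_flats flat_mult_in_order_flats flat_mult_assoc
    flat_mult_Union_right flat_mult_Union_left)

lemma quantic_semiring_order_flats:
  "quantic_semiring (order_flats (\<preceq>)) (\<subseteq>) (\<lambda>X. \<Union>X)
    (flat_mult (\<preceq>)) (flat_add (\<preceq>)) (flat_zero (\<preceq>))"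
proof (intro quantic_semiring.intro quantic_semiring_axioms.intro)
  fix S T U
  show "flat_mult (\<preceq>) (flat_add (\<preceq>) S T) U \<subseteq>
      flat_add (\<preceq>) (flat_mult (\<preceq>) S U) (flat_mult (\<preceq>) T U)"
    \<comment> \<open>Commutativity acts as an ordered rewrite rule here and brings the left-hand
      law and the goal to a common form.\<close>
    using flat_mult_add_subset[of U S T] by (simp only: flat_mult_commute)
  show "flat_mult (\<preceq>) S (flat_zero (\<preceq>)) \<subseteq> flat_zero (\<preceq>)"
    using flat_zero_mult_subset[of S] by (simp only: flat_mult_commute)
qed (simp_all only: quantale_order_flats flat_add_comm_monoid flat_add_Union_right
    flat_add_Union_left flat_mult_add_subset flat_zero_mult_subset)

end

theorem proposition4p16:
  fixes r :: "'a::{comm_monoid_mult, mult_zero} multiset \<Rightarrow> 'a multiset \<Rightarrow> bool"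
  assumes "associative_ordered_blueprint r"
  shows "quantic_semiring (order_flats r) (\<subseteq>) (\<lambda>X. \<Union>X) (flat_mult r) (flat_add r) (flat_zero r)"
  using assms by (rule associative_ordered_blueprint.quantic_semiring_order_flats)

end
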